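(* The mechanism HERALD* (defined in the context) is individually rational, that is, for any worker $i\in\mathcal{W}$, the utility $u_i$ of worker $i$ satisfies $u_i\ge 0$.
   Context: Setting. $\mathcal{W}=\{1,\dots,m\}$ is a set of workers (also written $W$); $\mathcal{T}=\{\tau_1,\dots,\tau_n\}$ is a set of $n$ distinct tasks; $\mathcal{Y}=\{\Gamma_1,\dots,\Gamma_l\}$ is a family of $l<mn$ task subsets with $\bigcup_{j=1}^l\Gamma_j=\mathcal{T}$, each task lying in at least two of the $\Gamma_j$. Each worker $i$ has a true cost $c_i$ and submits a single bid $b_i\in[b_{\min},b_{\max}]$, with $b_{\min}=1$ and $b_{\max}$ a constant. Workers may be selfish or strategic, so a bid $b_i$ may a priori differ from the cost $c_i$. HERALD* has three phases. (1) Task-worker matching. Given a score function $u$ with sensitivity $\Delta u$ and a small constant $\epsilon>0$, put $\Pr(b_i)=\exp\left(\frac{\epsilon u(b_i)}{2\Delta u}\right)/\sum_{i'\in\mathcal{W}}\exp\left(\frac{\epsilon u(b_{i'})}{2\Delta u}\right)$. For each $\Gamma_j\in\mathcal{Y}$ a worker $i$ is drawn at random from this distribution and the pair $(\Gamma_j,b_i)$ is put in the matching set $\mathcal{P}$. A worker may be matched with several subsets. It is required that each task is matched by at least two different workers, and it is assumed that the tasks of a worker's matched subset are covered by the task subsets matched with other workers. (2) Winning selection. Let $k$ be the number of tasks arriving simultaneously, let $\mathcal{A}$ be the random collection (repetitions allowed) of $k$ tasks arriving from $\mathcal{T}$ according to the given arrival distribution, and let $C_{\mathcal{OPT}}(\mathcal{A},W)$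 be the minimum social cost for $\mathcal{A}$, i.e. the minimum total cost of a set of matching pairs whose task subsets cover $\mathcal{A}$. Set $T=64\,\mathbb{E}[C_{\mathcal{OPT}}(\mathcal{A},W)]$ (fixed throughout) and $\mathcal{S}=\emptyset$. In the following loop $\mathcal{T}$ denotes the current set of not yet covered tasks. While $\mathcal{T}\neq\emptyset$: for each pair $(\Gamma_j,b_i)\in\mathcal{P}$ let its cost-effectiveness (CF) be $b_i/|\Gamma_j\cap\mathcal{T}|$ (infinite if the intersection is empty). Type I selection: if some pair has CF $\le T/|\mathcal{T}|$, select a pair with minimum CF. Type II selection: otherwise, select a pair with the lowest bid among those pairs whose subset contains at least one uncovered task. Add the selected pair $(\Gamma_j,b_i)$ to $\mathcal{S}$, remove it from $\mathcal{P}$, and replace $\mathcal{T}$ by $\mathcal{T}\setminus\Gamma_j$. The output is the winning set $\mathcal{S}$; worker $i$ wins if $\mathcal{S}$ contains a pair of worker $i$. (3) Payment determination. Start with $p_i=0$ for all $i$. For each winning pair $(\Gamma_j,b_i)\in\mathcal{S}$: set $\mathcal{T}_j=\Gamma_j$, let the covering set be $\mathcal{W}_i=\{\ell\in\mathcal{W}\setminus\{i\}:\Gamma_\ell\cap\mathcal{T}_j\ne\emptyset\}$, where $\Gamma_\ell$ denotes the task subset matched with worker $\ell$, and set $\mathcal{R}_i=\emptyset$. While $\mathcal{T}_j\neq\emptyset$, choose $\ell\in\mathcal{W}_i$ whose matched task subset has minimum CF (computed with respect to the current $\mathcal{T}_j$, i.e. $b_\ell/|\Gamma_\ell\cap\mathcal{T}_j|$),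 add $\ell$ to $\mathcal{R}_i$, and replace $\mathcal{T}_j$ by $\mathcal{T}_j\setminus\Gamma_\ell$. Then replace $p_i$ by $p_i+\max\{b_i,\sum_{\ell\in\mathcal{R}_i}b_\ell\}$. Utility. $u_i=p_i-c_i$ if worker $i$ wins, and $u_i=0$ otherwise.
   Formalization: The formal theorem assumes that worker i does not bid below the true cost (c_i ≤ b_i, which includes truthful bids); without this the claim fails, since an underbidding winner can be paid less than the cost. *)

theory Defs
  imports "HOL-Probability.Probability" "HOL-Probability.Product_PMF" "HOL-Library.Multiset"
begin

text \<open>
  Workers are the numbers in \<open>{1..m}\<close>; the family of task subsets is \<open>\<Gamma> j\<close> for
  \<open>j \<in> {1..l}\<close>; \<open>b i\<close> is the bid and \<open>c i\<close> the true cost of worker \<open>i\<close>.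
  A matching pair \<open>(\<Gamma> j, b i)\<close> is encoded by the pair of indices \<open>(j, i)\<close>, so that
  equal bids of different workers are kept apart.
\<close>

text \<open>
  The score of a worker depends on that worker's bid only, so the sensitivity of the score,
  i.e. the largest change when one bid changes, is the least upper bound of the differences of
  two score values on the bid range.
\<close>

definition has_sensitivity :: "(real \<Rightarrow> real) \<Rightarrow> real set \<Rightarrow> real \<Rightarrow> bool" where
  "has_sensitivity u B \<Delta>u \<longleftrightarrow>
     (\<forall>x\<in>B. \<forall>y\<in>B. \<bar>u x - u y\<bar> \<le> \<Delta>u) \<and>
     (\<forall>d. (\<forall>x\<in>B. \<forall>y\<in>B. \<bar>u x - u y\<bar> \<le> d) \<longrightarrow> \<Delta>u \<le> d)"

text \<open>
  For a constant score the sensitivity is 0, the quotient below is 0 by convention, and the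
  distribution is uniform.
\<close>

definition worker_prob ::
  "nat \<Rightarrow> (real \<Rightarrow> real) \<Rightarrow> real \<Rightarrow> real \<Rightarrow> (nat \<Rightarrow> real) \<Rightarrow> nat \<Rightarrow> real" where
  "worker_prob m u \<Delta>u \<epsilon> b i =
     (if i \<in> {1..m}
      then exp (\<epsilon> * u (b i) / (2 * \<Delta>u)) / (\<Sum>i'\<in>{1..m}. exp (\<epsilon> * u (b i') / (2 * \<Delta>u)))
      else 0)"

definition worker_pmf ::
  "nat \<Rightarrow> (real \<Rightarrow> real) \<Rightarrow> real \<Rightarrow> real \<Rightarrow> (nat \<Rightarrow> real) \<Rightarrow> nat pmf" where
  "worker_pmf m u \<Delta>u \<epsilon> b = embed_pmf (worker_prob m u \<Delta>u \<epsilon> b)"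

text \<open>
  One independent draw for each \<open>j \<in> {1..l}\<close>; a sample \<open>\<mu>\<close> maps \<open>j\<close> to the worker matched
  with \<open>\<Gamma> j\<close>, and to the dummy value 0 for \<open>j\<close> outside \<open>{1..l}\<close>.
\<close>

definition matching_pmf ::
  "nat \<Rightarrow> nat \<Rightarrow> (real \<Rightarrow> real) \<Rightarrow> real \<Rightarrow> real \<Rightarrow> (nat \<Rightarrow> real) \<Rightarrow> (nat \<Rightarrow> nat) pmf" where
  "matching_pmf m l u \<Delta>u \<epsilon> b = Pi_pmf {1..l} 0 (\<lambda>_. worker_pmf m u \<Delta>u \<epsilon> b)"

definition matching_set :: "nat \<Rightarrow> (nat \<Rightarrow> nat) \<Rightarrow> (nat \<times> nat) set" where
  "matching_set l \<mu> = {(j, \<mu> j) | j. j \<in> {1..l}}"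

definition two_workers_per_task :: "(nat \<Rightarrow> 'a set) \<Rightarrow> 'a set \<Rightarrow> (nat \<times> nat) set \<Rightarrow> bool" where
  "two_workers_per_task \<Gamma> \<T> P \<longleftrightarrow> (\<forall>t\<in>\<T>. 2 \<le> card {i. \<exists>j. (j, i) \<in> P \<and> t \<in> \<Gamma> j})"

definition covered_by_others :: "(nat \<Rightarrow> 'a set) \<Rightarrow> (nat \<times> nat) set \<Rightarrow> bool" where
  "covered_by_others \<Gamma> P \<longleftrightarrow> (\<forall>(j, i)\<in>P. \<Gamma> j \<subseteq> (\<Union>(j', i')\<in>{q \<in> P. snd q \<noteq> i}. \<Gamma> j'))"

definition opt_cost ::
  "(nat \<Rightarrow> 'a set) \<Rightarrow> (nat \<Rightarrow> real) \<Rightarrow> (nat \<times> nat) set \<Rightarrow> 'a multiset \<Rightarrow> real" where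
  "opt_cost \<Gamma> b P A =
     Min {(\<Sum>(j, i)\<in>Q. b i) | Q. Q \<subseteq> P \<and> set_mset A \<subseteq> (\<Union>(j, i)\<in>Q. \<Gamma> j)}"

definition threshold ::
  "(nat \<Rightarrow> 'a set) \<Rightarrow> (nat \<Rightarrow> real) \<Rightarrow> (nat \<times> nat) set \<Rightarrow> 'a multiset pmf \<Rightarrow> real" where
  "threshold \<Gamma> b P arrivals = 64 * measure_pmf.expectation arrivals (opt_cost \<Gamma> b P)"

definition cost_eff ::
  "(nat \<Rightarrow> 'a set) \<Rightarrow> (nat \<Rightarrow> real) \<Rightarrow> 'a set \<Rightarrow> nat \<times> nat \<Rightarrow> ereal" where
  "cost_eff \<Gamma> b U = (\<lambda>(j, i).
     if \<Gamma> j \<inter> U = {} then \<infinity> else ereal (b i / real (card (\<Gamma> j \<inter> U))))"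

definition min_cost_eff ::
  "(nat \<Rightarrow> 'a set) \<Rightarrow> (nat \<Rightarrow> real) \<Rightarrow> 'a set \<Rightarrow> (nat \<times> nat) set \<Rightarrow> nat \<times> nat \<Rightarrow> bool" where
  "min_cost_eff \<Gamma> b U P p \<longleftrightarrow> p \<in> P \<and> (\<forall>q\<in>P. cost_eff \<Gamma> b U p \<le> cost_eff \<Gamma> b U q)"

definition min_bid ::
  "(nat \<Rightarrow> 'a set) \<Rightarrow> (nat \<Rightarrow> real) \<Rightarrow> 'a set \<Rightarrow> (nat \<times> nat) set \<Rightarrow> nat \<times> nat \<Rightarrow> bool" where
  "min_bid \<Gamma> b U P p \<longleftrightarrow>
     p \<in> P \<and> \<Gamma> (fst p) \<inter> U \<noteq> {} \<and>
     (\<forall>q\<in>P. \<Gamma> (fst q) \<inter> U \<noteq> {} \<longrightarrow> b (snd p) \<le> b (snd q))"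

definition selects ::
  "(nat \<Rightarrow> 'a set) \<Rightarrow> (nat \<Rightarrow> real) \<Rightarrow> real \<Rightarrow> (nat \<times> nat) set \<Rightarrow> 'a set \<Rightarrow> nat \<times> nat \<Rightarrow> bool" where
  "selects \<Gamma> b T P U p \<longleftrightarrow>
     (if \<exists>q\<in>P. cost_eff \<Gamma> b U q \<le> ereal (T / real (card U))
      then min_cost_eff \<Gamma> b U P p
      else min_bid \<Gamma> b U P p)"

text \<open>
  Ties in the two loops of the mechanism may be broken in any way, so the loops are relations.
  \<open>winning_selection \<Gamma> b T P U S\<close>: the selection loop, started with the available pairs
  \<open>P\<close> and the uncovered tasks \<open>U\<close>, can terminate having selected exactly the pairs \<open>S\<close>.
\<close>

inductive winning_selection ::
  "(nat \<Rightarrow> 'a set) \<Rightarrow> (nat \<Rightarrow> real) \<Rightarrow> real \<Rightarrow>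
   (nat \<times> nat) set \<Rightarrow> 'a set \<Rightarrow> (nat \<times> nat) set \<Rightarrow> bool"
  for \<Gamma> :: "nat \<Rightarrow> 'a set" and b :: "nat \<Rightarrow> real" and T :: real where
  stop: "winning_selection \<Gamma> b T P {} {}"
| step: "\<lbrakk>U \<noteq> {}; selects \<Gamma> b T P U p; winning_selection \<Gamma> b T (P - {p}) (U - \<Gamma> (fst p)) S\<rbrakk>
         \<Longrightarrow> winning_selection \<Gamma> b T P U (insert p S)"

text \<open>
  A worker may be matched with several subsets, so the covering set of a winning pair
  \<open>(j, i)\<close> is kept as the set of matching pairs of the other workers that meet \<open>\<Gamma> j\<close>.
\<close>

definition covering_pairs ::
  "(nat \<Rightarrow> 'a set) \<Rightarrow> (nat \<times> nat) set \<Rightarrow> nat \<times> nat \<Rightarrow> (nat \<times> nat) set" where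
  "covering_pairs \<Gamma> P = (\<lambda>(j, i). {q \<in> P. snd q \<noteq> i \<and> \<Gamma> (fst q) \<inter> \<Gamma> j \<noteq> {}})"

text \<open>
  \<open>replacement \<Gamma> b C U R\<close>: the payment loop, started with the covering pairs \<open>C\<close> and the
  remaining tasks \<open>U\<close>, can terminate having chosen exactly the workers \<open>R\<close>.
\<close>

inductive replacement ::
  "(nat \<Rightarrow> 'a set) \<Rightarrow> (nat \<Rightarrow> real) \<Rightarrow> (nat \<times> nat) set \<Rightarrow> 'a set \<Rightarrow> nat set \<Rightarrow> bool"
  for \<Gamma> :: "nat \<Rightarrow> 'a set" and b :: "nat \<Rightarrow> real" and C :: "(nat \<times> nat) set" where
  stop: "replacement \<Gamma> b C {} {}"
| step: "\<lbrakk>U \<noteq> {}; min_cost_eff \<Gamma> b U C q; replacement \<Gamma> b C (U - \<Gamma> (fst q)) R\<rbrakk>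
         \<Longrightarrow> replacement \<Gamma> b C U (insert (snd q) R)"

text \<open>
  Possible results of the selection and payment phases on the matching set \<open>P\<close>: the
  winning set \<open>S\<close> and, for every winning pair \<open>p\<close>, the set \<open>R p\<close> of replacing workers.
\<close>

definition herald_outcome ::
  "(nat \<Rightarrow> 'a set) \<Rightarrow> 'a set \<Rightarrow> (nat \<Rightarrow> real) \<Rightarrow> 'a multiset pmf \<Rightarrow> (nat \<times> nat) set \<Rightarrow>
   (nat \<times> nat) set \<Rightarrow> (nat \<times> nat \<Rightarrow> nat set) \<Rightarrow> bool" where
  "herald_outcome \<Gamma> \<T> b arrivals P S R \<longleftrightarrow>
     winning_selection \<Gamma> b (threshold \<Gamma> b P arrivals) P \<T> S \<and>
     (\<forall>p\<in>S. replacement \<Gamma> b (covering_pairs \<Gamma> P p) (\<Gamma> (fst p)) (R p))"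

definition payment ::
  "(nat \<Rightarrow> real) \<Rightarrow> (nat \<times> nat) set \<Rightarrow> (nat \<times> nat \<Rightarrow> nat set) \<Rightarrow> nat \<Rightarrow> real" where
  "payment b S R i = (\<Sum>p\<in>{p \<in> S. snd p = i}. max (b i) (\<Sum>i'\<in>R p. b i'))"

text \<open>
  A worker who bids below the true cost can end up with negative utility; individual rationality
  concerns workers with \<open>c i \<le> b i\<close>, in particular truthful ones (\<open>c i = b i\<close>).
\<close>

definition utility ::
  "(nat \<Rightarrow> real) \<Rightarrow> (nat \<Rightarrow> real) \<Rightarrow> (nat \<times> nat) set \<Rightarrow> (nat \<times> nat \<Rightarrow> nat set) \<Rightarrow> nat \<Rightarrow> real" where
  "utility b c S R i = (if \<exists>j. (j, i) \<in> S then payment b S R i - c i else 0)"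

end

theory Submission
  imports Defs
begin

text \<open>The payment for each winning pair is a maximum with the worker's own bid as one
  argument, so a single won pair already pays at least \<open>b i\<close>. Further pairs of the same
  worker add only nonnegative amounts, while the cost is subtracted once. Hence a winner receives at
  least \<open>b i\<close>, which is at least \<open>c i\<close> (\<open>bid_le_payment\<close>); a
  loser has utility 0.\<close>

text \<open>Needed because \<open>payment\<close> sums over winning pairs, and a sum over an
  infinite set would be 0 by convention.\<close>

lemma winning_selection_finite: "winning_selection \<Gamma> b T P U S \<Longrightarrow> finite S"
  by (induction rule: winning_selection.induct) auto

lemma bid_le_payment:
  assumes "finite S" and "(j, i) \<in> S" and "0 \<le> b i"
  shows "b i \<le> payment b S R i"
proof -
  have "b i \<le> max (b i) (\<Sum>i'\<in>R (j, i). b i')"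
    by simp
  \<comment> \<open>One summand is bounded by the whole sum: every other summand is a maximum with
    \<open>b i\<close>, hence nonnegative.\<close>
  also have "\<dots> \<le> payment b S R i"
    unfolding payment_def
    using assms by (intro member_le_sum) (auto simp: le_max_iff_disj)
  finally show ?thesis .
qed

theorem lemma1:
  fixes m n l k :: nat
    and \<tau> :: "nat \<Rightarrow> 'a" and \<Gamma> :: "nat \<Rightarrow> 'a set" and \<T> :: "'a set"
    and b c :: "nat \<Rightarrow> real" and b_max :: real
    and u :: "real \<Rightarrow> real" and \<Delta>u \<epsilon> :: real
    and arrivals :: "'a multiset pmf"
    and \<mu> :: "nat \<Rightarrow> nat" and P S :: "(nat \<times> nat) set" and R :: "nat \<times> nat \<Rightarrow> nat set"
    and i :: nat
  assumes "inj_on \<tau> {1..n}" and "\<T> = \<tau> ` {1..n}"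
    and "l < m * n"
    and "(\<Union>j\<in>{1..l}. \<Gamma> j) = \<T>"
    and "\<forall>t\<in>\<T>. 2 \<le> card {j \<in> {1..l}. t \<in> \<Gamma> j}"
    and "\<forall>i\<in>{1..m}. b i \<in> {1..b_max}"
    and "has_sensitivity u {1..b_max} \<Delta>u" and "\<epsilon> > 0"
    and "\<forall>A\<in>set_pmf arrivals. size A = k \<and> set_mset A \<subseteq> \<T>"
    and "\<mu> \<in> set_pmf (matching_pmf m l u \<Delta>u \<epsilon> b)"
    and "P = matching_set l \<mu>"
    and "two_workers_per_task \<Gamma> \<T> P" and "covered_by_others \<Gamma> P"
    and "herald_outcome \<Gamma> \<T> b arrivals P S R"
    and "i \<in> {1..m}"
    and "c i \<le> b i"
  shows "utility b c S R i \<ge> 0"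
proof (cases "\<exists>j. (j, i) \<in> S")
  case True
  then obtain j where "(j, i) \<in> S" ..
  moreover have "finite S"
    using assms(14) winning_selection_finite unfolding herald_outcome_def by blast
  \<comment> \<open>The bid range starts at 1.\<close>
  moreover have "0 \<le> b i"
    using assms(6,15) by fastforce
  ultimately have "b i \<le> payment b S R i"
    by (intro bid_le_payment)
  with assms(16) True show ?thesis
    by (simp add: utility_def)
qed (simp add: utility_def)

end
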